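(* For every $k\ge 3$ and every $q\ge 2$ there are positive constants $c,c'$ depending only on $k$ and $q$ such that for every integer $n\ge 4k$, $$t_{k-1}(c\,n^{q-1})\le N_k(q,n)\le t_{k-1}(c'\,n^{q-1}\log_2 n).$$
   Context: For integers $k\ge 1$, $q\ge 1$, $n\ge k$, a monotone (tight) path of length $n$ in the complete $k$-uniform hypergraph on $[N]=\{1,\dots,N\}$ is given by integers $j_1<\dots<j_n$ in $[N]$ together with the $k$-sets $\{j_i,\dots,j_{i+k-1}\}$, $i=1,\dots,n-k+1$. $N_k(q,n)$ is the smallest $N$ such that every $q$-coloring of the $k$-element subsets of $[N]$ contains a monotone path of length $n$ all of whose $k$-sets have the same color. The tower function is defined by $t_1(x)=x$ and $t_{i+1}(x)=2^{t_i(x)}$. *)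

theory Defs
  imports Complex_Main "HOL-Library.Ramsey" "HOL-Library.FuncSet"
begin

text \<open>A path of length \<open>n\<close> has \<open>n\<close> vertices \<open>j 1 < \<dots> < j n\<close>; its edges are the sets of
  \<open>k\<close> consecutive vertices.\<close>

definition monotone_path :: "nat \<Rightarrow> nat \<Rightarrow> (nat \<Rightarrow> nat) \<Rightarrow> bool" where
  "monotone_path N n j \<longleftrightarrow> strict_mono_on {1..n} j \<and> j ` {1..n} \<subseteq> {1..N}"

definition path_edges :: "nat \<Rightarrow> nat \<Rightarrow> (nat \<Rightarrow> nat) \<Rightarrow> nat set set" where
  "path_edges k n j = (\<lambda>i. j ` {i..i + k - 1}) ` {1..n - k + 1}"

definition forces_mono_path :: "nat \<Rightarrow> nat \<Rightarrow> nat \<Rightarrow> nat \<Rightarrow> bool" where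
  "forces_mono_path k q n N \<longleftrightarrow>
     (\<forall>\<chi> \<in> [{1..N}]\<^bsup>k\<^esup> \<rightarrow> {1..q}.
        \<exists>j. monotone_path N n j \<and> (\<exists>a. \<forall>e \<in> path_edges k n j. \<chi> e = a))"

definition mono_path_number :: "nat \<Rightarrow> nat \<Rightarrow> nat \<Rightarrow> nat" where
  "mono_path_number k q n = (LEAST N. forces_mono_path k q n N)"

text \<open>Only indices \<open>i \<ge> 1\<close> are meaningful; the value at index \<open>0\<close> is a dummy.\<close>

fun tower :: "nat \<Rightarrow> real \<Rightarrow> real" where
  "tower 0 x = x"
| "tower (Suc 0) x = x"
| "tower (Suc (Suc i)) x = 2 powr tower (Suc i) x"

text \<open>By Ramsey's theorem the minimum defining \<open>mono_path_number\<close> is attained.\<close>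

lemma forces_mono_path_exists:
  assumes "1 \<le> k" "k \<le> n"
  shows "\<exists>N. forces_mono_path k q n N"
proof -
  obtain N :: nat where N: "partn_lst {..<N} (replicate q n) k"
    using ramsey_full by blast
  have "forces_mono_path k q n N"
    unfolding forces_mono_path_def
  proof
    fix \<chi> assume \<chi>: "\<chi> \<in> [{1..N}]\<^bsup>k\<^esup> \<rightarrow> {1..q}"
    define g where "g X = \<chi> (Suc ` X) - 1" for X
    have im: "Suc ` X \<in> [{1..N}]\<^bsup>k\<^esup>" if "X \<in> [{..<N}]\<^bsup>k\<^esup>" for X
      using that by (auto simp: nsets_def card_image)
    have \<chi>im: "\<chi> (Suc ` X) \<in> {1..q}" if "X \<in> [{..<N}]\<^bsup>k\<^esup>" for X
      using \<chi> im[OF that] by blast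
    have "g \<in> [{..<N}]\<^bsup>k\<^esup> \<rightarrow> {..<length (replicate q n)}"
    proof
      fix X assume "X \<in> [{..<N}]\<^bsup>k\<^esup>"
      from \<chi>im[OF this] show "g X \<in> {..<length (replicate q n)}"
        by (auto simp: g_def)
    qed
    then obtain a where a: "a < q" "monochromatic {..<N} n k g a"
      using N unfolding partn_lst_def by (metis length_replicate nth_replicate)
    then obtain H where H: "H \<subseteq> {..<N}" "finite H" "card H = n" "g ` [H]\<^bsup>k\<^esup> \<subseteq> {a}"
      unfolding monochromatic_def nsets_def by auto
    define h where "h i = sorted_list_of_set H ! (i - 1)" for i
    define j where "j = Suc \<circ> h"
    have len: "length (sorted_list_of_set H) = n"
      using H by simp
    have hH: "h i \<in> H" if "i \<in> {1..n}" for i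
      using that len H nth_mem[of "i - 1" "sorted_list_of_set H"] by (auto simp: h_def)
    have hmono: "strict_mono_on {1..n} h"
    proof (rule strict_mono_onI)
      fix r s assume "r \<in> {1..n}" "s \<in> {1..n}" "r < s"
      then have "r - 1 < s - 1" "s - 1 < length (sorted_list_of_set H)"
        using len by auto
      then show "h r < h s"
        unfolding h_def by (rule sorted_wrt_nth_less[OF strict_sorted_list_of_set])
    qed
    have "monotone_path N n j"
      unfolding monotone_path_def
    proof
      show "strict_mono_on {1..n} j"
        using hmono by (simp add: j_def strict_mono_on_def)
      show "j ` {1..n} \<subseteq> {1..N}"
        using hH H(1) by (fastforce simp: j_def)
    qed
    moreover have "\<chi> e = Suc a" if e: "e \<in> path_edges k n j" for e
    proof -
      obtain i where i: "i \<in> {1..n - k + 1}" "e = j ` {i..i + k - 1}"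
        using e unfolding path_edges_def by blast
      let ?I = "{i..i + k - 1}"
      have sub: "?I \<subseteq> {1..n}"
        using i assms by auto
      have "inj_on h ?I"
        using strict_mono_on_imp_inj_on[OF hmono] sub inj_on_subset by blast
      then have "card (h ` ?I) = k"
        using assms by (simp add: card_image)
      then have hI: "h ` ?I \<in> [H]\<^bsup>k\<^esup>"
        using hH sub by (auto simp: nsets_def subset_iff)
      then have "g (h ` ?I) = a"
        using H(4) by blast
      moreover have "\<chi> (Suc ` h ` ?I) \<in> {1..q}"
        using \<chi>im hI nsets_mono[OF H(1)] by blast
      moreover have "e = Suc ` h ` ?I"
        using i by (simp add: j_def image_comp)
      ultimately show ?thesis
        by (auto simp: g_def)
    qed
    ultimately show "\<exists>j. monotone_path N n j \<and> (\<exists>a. \<forall>e \<in> path_edges k n j. \<chi> e = a)"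
      by blast
  qed
  then show ?thesis ..
qed

end

theory Submission
  imports Defs
begin

text \<open>
  Fix a coloring of the \<open>k\<close>-sets and put \<open>m = n - k + 1\<close>. For a \<open>(k-1)\<close>-set \<open>v\<close>, record for each
  color the number of edges of a longest monochromatic path of that color ending in \<open>v\<close>. If there
  is no monochromatic path of length \<open>n\<close>, this maps the \<open>(k-1)\<close>-sets to the grid \<open>[m]\<^sup>q\<close>, and the
  value at the final \<open>(k-1)\<close>-set of an edge is never at most the value at its initial one.
  Conversely every such map yields a coloring. Replacing the poset of values by its poset of
  down-sets lowers the uniformity by one, and for singletons such a map exists iff there are at
  most as many vertices as values.

  The grid is covered by \<open>m^(q-1)\<close> chains of size \<open>m\<close>, so it has at most \<open>(m+1)^(m^(q-1))\<close>
  down-sets; every further passage to down-sets at most exponentiates the size. One layer of the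
  grid is an antichain of size at least \<open>m^(q-1)/(q-1)\<close>. An antichain of size \<open>w\<close> yields, through
  the down-sets generated by its subsets of size \<open>w div 2\<close>, an antichain of at least
  \<open>2^(w div 2)\<close> down-sets, which gives the lower bound.
\<close>

section \<open>Finite posets and their down-sets\<close>

definition down_sets :: "'a::order set \<Rightarrow> 'a set set" where
  "down_sets P = {D. D \<subseteq> P \<and> (\<forall>x\<in>D. \<forall>y\<in>P. y \<le> x \<longrightarrow> y \<in> D)}"

definition down_closure :: "'a::order set \<Rightarrow> 'a set \<Rightarrow> 'a set" where
  "down_closure P B = {y \<in> P. \<exists>x\<in>B. y \<le> x}"

definition antichain :: "'a::order set \<Rightarrow> bool" where
  "antichain A \<longleftrightarrow> (\<forall>x\<in>A. \<forall>y\<in>A. x \<le> y \<longrightarrow> x = y)"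

definition order_embedding_on :: "'a::order set \<Rightarrow> ('a \<Rightarrow> 'b::order) \<Rightarrow> bool" where
  "order_embedding_on P e \<longleftrightarrow> (\<forall>x\<in>P. \<forall>y\<in>P. e x \<le> e y \<longleftrightarrow> x \<le> y)"

lemma down_closure_in_down_sets: "down_closure P B \<in> down_sets P"
  unfolding down_closure_def down_sets_def by (auto intro: order_trans)

lemma down_sets_subset_Pow: "down_sets P \<subseteq> Pow P"
  by (auto simp: down_sets_def)

lemma finite_down_sets: "finite P \<Longrightarrow> finite (down_sets P)"
  using down_sets_subset_Pow finite_subset by blast

lemma card_down_sets_le: "finite P \<Longrightarrow> card (down_sets P) \<le> 2 ^ card P"
  using card_mono[OF _ down_sets_subset_Pow[of P]] by (simp add: card_Pow)

lemma order_embedding_on_subset: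
  "order_embedding_on P e \<Longrightarrow> Q \<subseteq> P \<Longrightarrow> order_embedding_on Q e"
  unfolding order_embedding_on_def by blast

lemma order_embedding_on_imp_inj_on: "order_embedding_on P e \<Longrightarrow> inj_on e P"
  unfolding order_embedding_on_def by (intro inj_onI) (metis order_antisym order_refl)

lemma antichain_subset: "antichain A \<Longrightarrow> B \<subseteq> A \<Longrightarrow> antichain B"
  unfolding antichain_def by blast

lemma antichain_image:
  "antichain A \<Longrightarrow> order_embedding_on A e \<Longrightarrow> antichain (e ` A)"
  unfolding antichain_def order_embedding_on_def by blast

lemma antichain_nsets: "antichain ([A]\<^bsup>k\<^esup>)"
  unfolding antichain_def nsets_def by (simp add: card_subset_eq)

text \<open>An induction cannot run through the types of iterated down-sets; replacing each poset by an
  isomorphic family of sets of naturals keeps the type fixed.\<close>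

lemma ex_order_embedding_nat_set:
  assumes "finite P"
  shows "\<exists>e :: 'a::order \<Rightarrow> nat set. order_embedding_on P e"
proof -
  obtain g :: "'a \<Rightarrow> nat" where g: "inj_on g P"
    using finite_imp_inj_to_nat_seg[OF assms] by blast
  have "order_embedding_on P (\<lambda>x. g ` {y \<in> P. y \<le> x})"
    unfolding order_embedding_on_def
  proof (intro ballI iffI)
    fix x y assume "x \<in> P" and sub: "g ` {z \<in> P. z \<le> x} \<subseteq> g ` {z \<in> P. z \<le> y}"
    then have "g x \<in> g ` {z \<in> P. z \<le> y}" by blast
    then show "x \<le> y"
      using inj_on_image_mem_iff[OF g \<open>x \<in> P\<close>] by auto
  qed force
  then show ?thesis by blast
qed

lemma finite_linear_extension:
  fixes P :: "'a::order set"
  assumes "finite P"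
  shows "\<exists>h. bij_betw h {..<card P} P \<and> (\<forall>j<card P. \<forall>i<j. \<not> h j \<le> h i)"
  using assms
proof (induction "card P" arbitrary: P)
  case 0
  then show ?case by (simp add: bij_betw_def)
next
  case (Suc r)
  then obtain t where t: "t \<in> P" and maximal: "\<And>x. x \<in> P \<Longrightarrow> t \<le> x \<Longrightarrow> t = x"
    using finite_has_maximal[of P] by (metis card.empty nat.distinct(1))
  have card: "r = card (P - {t})"
    using Suc.hyps(2) Suc.prems t by simp
  then obtain h where bij: "bij_betw h {..<r} (P - {t})"
    and ext: "\<forall>j<r. \<forall>i<j. \<not> h j \<le> h i"
    using Suc.hyps(1)[of "P - {t}"] Suc.prems by auto
  have "bij_betw (h(r := t)) {..<r} (P - {t})"
    using bij by (subst bij_betw_cong[where g = h]) auto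
  then have "bij_betw (h(r := t)) (insert r {..<r}) (insert t (P - {t}))"
    using notIn_Un_bij_betw[of r "{..<r}" "h(r := t)" "P - {t}"] by simp
  moreover have "insert r {..<r} = {..<card P}" "insert t (P - {t}) = P"
    using Suc.hyps(2) t by auto
  ultimately have "bij_betw (h(r := t)) {..<card P} P" by simp
  moreover have "\<not> t \<le> h i" if "i < r" for i
    using bij_betwE[OF bij] maximal that by blast
  then have "\<forall>j<card P. \<forall>i<j. \<not> (h(r := t)) j \<le> (h(r := t)) i"
    using ext Suc.hyps(2) by (auto simp: less_Suc_eq simp flip: Suc.hyps(2))
  ultimately show ?case by blast
qed

lemma down_set_inter_chain_eqI:
  assumes D: "D \<in> down_sets P" and E: "E \<in> down_sets P"
    and C: "C \<subseteq> P" "finite C" "Complete_Partial_Order.chain (\<le>) C"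
    and card: "card (D \<inter> C) = card (E \<inter> C)"
  shows "D \<inter> C = E \<inter> C"
proof -
  have "D \<inter> C \<subseteq> E \<inter> C \<or> E \<inter> C \<subseteq> D \<inter> C"
  proof (rule ccontr)
    assume "\<not> ?thesis"
    then obtain x y where "x \<in> D" "x \<in> C" "x \<notin> E" "y \<in> E" "y \<in> C" "y \<notin> D" by blast
    with chainD[OF C(3), of x y] D E C(1) show False unfolding down_sets_def by blast
  qed
  then show ?thesis using card C(2) by (metis card_subset_eq finite_Int)
qed

lemma card_down_sets_chain_cover:
  assumes P: "finite P" and I: "finite I" and cover: "P = (\<Union>i\<in>I. C i)"
    and chain: "\<And>i. i \<in> I \<Longrightarrow> Complete_Partial_Order.chain (\<le>) (C i)"
    and card: "\<And>i. i \<in> I \<Longrightarrow> card (C i) \<le> s"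
  shows "card (down_sets P) \<le> (s + 1) ^ card I"
proof -
  define h where "h D = (\<lambda>i\<in>I. card (D \<inter> C i))" for D
  have C: "C i \<subseteq> P" "finite (C i)" if "i \<in> I" for i
    using P that cover by (auto intro: finite_subset)
  have "inj_on h (down_sets P)"
  proof (rule inj_onI)
    fix D E assume D: "D \<in> down_sets P" and E: "E \<in> down_sets P" and eq: "h D = h E"
    have "D \<inter> C i = E \<inter> C i" if "i \<in> I" for i
      using fun_cong[OF eq, of i] that
      by (intro down_set_inter_chain_eqI[OF D E C chain]) (auto simp: h_def)
    then have "D \<inter> P = E \<inter> P" unfolding cover by blast
    then show "D = E" using D E by (auto simp: down_sets_def)
  qed
  moreover have "h ` down_sets P \<subseteq> I \<rightarrow>\<^sub>E {..s}"
  proof -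
    have "card (D \<inter> C i) \<le> s" if "i \<in> I" for D i
      using card_mono[OF C(2)[OF that], of "D \<inter> C i"] card[OF that] by simp
    then show ?thesis by (auto simp: h_def)
  qed
  ultimately have "card (down_sets P) \<le> card (I \<rightarrow>\<^sub>E {..s})"
    by (intro card_inj_on_le) (auto simp: finite_PiE I)
  also have "\<dots> = (s + 1) ^ card I" using I by (simp add: card_PiE)
  finally show ?thesis .
qed

lemma order_embedding_on_Pow_down_closure:
  assumes "A \<subseteq> P" "antichain A"
  shows "order_embedding_on (Pow A) (down_closure P)"
  unfolding order_embedding_on_def
proof (intro ballI iffI)
  fix B B' assume "B \<in> Pow A" "B' \<in> Pow A" and sub: "down_closure P B \<subseteq> down_closure P B'"
  show "B \<subseteq> B'"
  proof
    fix x assume "x \<in> B"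
    then have "x \<in> down_closure P B'"
      using sub assms(1) \<open>B \<in> Pow A\<close> by (auto simp: down_closure_def)
    then obtain y where "y \<in> B'" "x \<le> y" by (auto simp: down_closure_def)
    then show "x \<in> B'"
      using assms(2) \<open>x \<in> B\<close> \<open>B \<in> Pow A\<close> \<open>B' \<in> Pow A\<close> by (auto simp: antichain_def)
  qed
qed (auto simp: down_closure_def)

lemma two_power_half_le_binomial: "2 ^ (w div 2) \<le> w choose (w div 2)"
proof -
  define r where "r = w div 2"
  have "(2::real) ^ r \<le> (real w / real r) ^ r"
  proof (cases "r = 0")
    case False
    then have "2 \<le> real w / real r" unfolding r_def by (simp add: field_simps)
    then show ?thesis by (intro power_mono) auto
  qed simp
  also have "\<dots> \<le> real (w choose r)"
    using binomial_ge_n_over_k_pow_k[of r w, where 'a = real] by (simp add: r_def)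
  finally show ?thesis unfolding r_def by (metis of_nat_le_iff of_nat_numeral of_nat_power)
qed

lemma ex_large_antichain_down_sets:
  assumes "finite A" "A \<subseteq> P" "antichain A"
  shows "\<exists>A'\<subseteq>down_sets P. antichain A' \<and> 2 ^ (card A div 2) \<le> card A'"
proof -
  let ?M = "[A]\<^bsup>(card A div 2)\<^esup>"
  have emb: "order_embedding_on ?M (down_closure P)"
    by (rule order_embedding_on_subset[OF order_embedding_on_Pow_down_closure[OF assms(2,3)]])
      (auto simp: nsets_def)
  have "card (down_closure P ` ?M) = card ?M"
    by (rule card_image[OF order_embedding_on_imp_inj_on[OF emb]])
  also have "\<dots> = card {B. B \<subseteq> A \<and> card B = card A div 2}"
    using assms(1) finite_subset by (intro arg_cong[where f = card]) (auto simp: nsets_def)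
  also have "\<dots> = card A choose (card A div 2)"
    by (rule n_subsets[OF assms(1)])
  finally have "card (down_closure P ` ?M) = card A choose (card A div 2)" .
  then show ?thesis
    using antichain_image[OF antichain_nsets emb] two_power_half_le_binomial
    by (intro exI[of _ "down_closure P ` ?M"]) (auto intro: down_closure_in_down_sets)
qed

section \<open>Homomorphisms of shift digraphs\<close>

text \<open>The shift digraph has an arc from \<open>e - {Max e}\<close> to \<open>e - {Min e}\<close> for every \<open>(k+1)\<close>-set \<open>e\<close>;
  it is mapped to the digraph on \<open>P\<close> with an arc from \<open>x\<close> to \<open>y\<close> unless \<open>y \<le> x\<close>.\<close>

definition shift_hom :: "'v::linorder set \<Rightarrow> nat \<Rightarrow> 'a::order set \<Rightarrow> ('v set \<Rightarrow> 'a) \<Rightarrow> bool" where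
  "shift_hom V k P f \<longleftrightarrow> f \<in> [V]\<^bsup>k\<^esup> \<rightarrow> P \<and>
     (\<forall>e\<in>[V]\<^bsup>Suc k\<^esup>. \<not> f (e - {Min e}) \<le> f (e - {Max e}))"

lemma nsets_Diff_Min: "e \<in> [V]\<^bsup>Suc k\<^esup> \<Longrightarrow> e - {Min e} \<in> [V]\<^bsup>k\<^esup>"
  using Min_in[of e] by (cases "e = {}") (auto simp: nsets_def)

lemma nsets_Diff_Max: "e \<in> [V]\<^bsup>Suc k\<^esup> \<Longrightarrow> e - {Max e} \<in> [V]\<^bsup>k\<^esup>"
  using Max_in[of e] by (cases "e = {}") (auto simp: nsets_def)

lemma Min_less_Max:
  assumes "e \<in> [V]\<^bsup>Suc (Suc k)\<^esup>"
  shows "Min e < Max e"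
proof -
  have e: "finite e" "card e \<ge> 2" using assms by (auto simp: nsets_def)
  have "Min e \<noteq> Max e"
  proof
    assume "Min e = Max e"
    then have "e \<subseteq> {Min e}" using e(1) by (metis Max_ge Min_le order_antisym singletonI subsetI)
    then show False using e(2) card_mono[of "{Min e}" e] by simp
  qed
  moreover have "Min e \<le> Max e" using e by (intro Min_le Max_in) auto
  ultimately show ?thesis by simp
qed

lemma Diff_Min_Diff_Max:
  assumes "e \<in> [V]\<^bsup>Suc (Suc k)\<^esup>"
  shows "e - {Min e} - {Max (e - {Min e})} = e - {Max e} - {Min (e - {Max e})}"
proof -
  have e: "finite e" "e \<noteq> {}" using assms by (auto simp: nsets_def)
  then have in_e: "Min e \<in> e" "Max e \<in> e" by simp_all
  have ne: "Min e \<noteq> Max e" using Min_less_Max[OF assms] by simp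
  have "Max (e - {Min e}) = Max e"
    by (rule Max_eqI) (use e(1) in_e ne in auto)
  moreover have "Min (e - {Max e}) = Min e"
    by (rule Min_eqI) (use e(1) in_e ne in auto)
  ultimately show ?thesis by auto
qed

lemma shift_hom_subset: "shift_hom V k P f \<Longrightarrow> U \<subseteq> V \<Longrightarrow> shift_hom U k P f"
  unfolding shift_hom_def by (meson Pi_anti_mono nsets_mono subsetD)

lemma shift_hom_embedding:
  assumes "order_embedding_on P e" "shift_hom V k P f"
  shows "shift_hom V k (e ` P) (e \<circ> f)"
proof -
  have "f (u - {Min u}) \<in> P" "f (u - {Max u}) \<in> P" if "u \<in> [V]\<^bsup>Suc k\<^esup>" for u
    using assms(2) nsets_Diff_Min[OF that] nsets_Diff_Max[OF that] by (auto simp: shift_hom_def)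
  then show ?thesis
    using assms unfolding shift_hom_def order_embedding_on_def by auto
qed

lemma shift_hom_inv_embedding:
  assumes e: "order_embedding_on P e" and f: "shift_hom V k (e ` P) f"
  shows "shift_hom V k P (inv_into P e \<circ> f)"
proof -
  have "order_embedding_on (e ` P) (inv_into P e)"
    using e order_embedding_on_imp_inj_on[OF e] by (auto simp: order_embedding_on_def)
  then have "shift_hom V k (inv_into P e ` e ` P) (inv_into P e \<circ> f)"
    using f by (rule shift_hom_embedding)
  then show ?thesis
    using order_embedding_on_imp_inj_on[OF e] by simp
qed

lemma shift_hom_not_le_insert_Diff_Max:
  assumes f: "shift_hom V (Suc k) P f" and e: "e \<in> [V]\<^bsup>Suc k\<^esup>"
    and x: "x \<in> V" "\<forall>y\<in>e. x < y"
  shows "\<not> f e \<le> f (insert x (e - {Max e}))"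
proof -
  have fin: "finite e" "e \<noteq> {}" using e by (auto simp: nsets_def)
  have "insert x e \<in> [V]\<^bsup>Suc (Suc k)\<^esup>" using e x by (auto simp: nsets_def)
  then have "\<not> f (insert x e - {Min (insert x e)}) \<le> f (insert x e - {Max (insert x e)})"
    using f unfolding shift_hom_def by blast
  moreover have "Min (insert x e) = x" "Max (insert x e) = Max e"
    using fin x(2) by (auto intro!: Min_eqI Max_eqI less_imp_le)
  moreover have "insert x e - {x} = e" "insert x e - {Max e} = insert x (e - {Max e})"
    using x(2) Max_in[OF fin] by auto
  ultimately show ?thesis by simp
qed

lemma shift_hom_imp_down_sets:
  assumes f: "shift_hom V (Suc k) P f" and k: "k \<ge> 1"
  shows "shift_hom V k (down_sets P)
    (\<lambda>v. down_closure P {f (insert x v) |x. x \<in> V \<and> (\<forall>y\<in>v. x < y)})"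
    (is "shift_hom V k _ ?D")
  unfolding shift_hom_def
proof (intro conjI ballI)
  show "?D \<in> [V]\<^bsup>k\<^esup> \<rightarrow> down_sets P"
    by (simp add: down_closure_in_down_sets)
next
  fix e assume e: "e \<in> [V]\<^bsup>Suc k\<^esup>"
  then have fin: "finite e" "e \<noteq> {}" "e \<subseteq> V" by (auto simp: nsets_def)
  have Min: "Min e \<in> e" "\<forall>y\<in>e - {Min e}. Min e < y"
    using fin by (auto simp: less_le)
  have "f e \<in> P" using f e by (auto simp: shift_hom_def)
  then have "f e \<in> ?D (e - {Min e})"
    unfolding down_closure_def using Min fin(3)
    by (auto intro!: exI[of _ "f e"] exI[of _ "Min e"] simp: insert_absorb)
  moreover have "f e \<notin> ?D (e - {Max e})"
  proof
    assume "f e \<in> ?D (e - {Max e})"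
    then obtain x where x: "x \<in> V" "\<forall>y\<in>e - {Max e}. x < y"
      and le: "f e \<le> f (insert x (e - {Max e}))"
      by (auto simp: down_closure_def)
    have "Min e < Max e" using e k Min_less_Max[of e V "k - 1"] by simp
    then have "x < Min e" using x(2) Min(1) by auto
    then have "\<forall>y\<in>e. x < y" using fin by simp
    then show False using shift_hom_not_le_insert_Diff_Max[OF f e x(1)] le by blast
  qed
  ultimately show "\<not> ?D (e - {Min e}) \<subseteq> ?D (e - {Max e})" by blast
qed

lemma down_sets_imp_ex_shift_hom:
  assumes D: "shift_hom V k (down_sets P) D"
  shows "\<exists>f. shift_hom V (Suc k) P f"
proof -
  have down: "D v \<in> down_sets P" if "v \<in> [V]\<^bsup>k\<^esup>" for v
    using D that by (auto simp: shift_hom_def)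
  have "\<exists>x. x \<in> D (e - {Min e}) \<and> x \<notin> D (e - {Max e})" if "e \<in> [V]\<^bsup>Suc k\<^esup>" for e
    using D that unfolding shift_hom_def by blast
  then obtain f where f: "\<And>e. e \<in> [V]\<^bsup>Suc k\<^esup> \<Longrightarrow> f e \<in> D (e - {Min e})"
    "\<And>e. e \<in> [V]\<^bsup>Suc k\<^esup> \<Longrightarrow> f e \<notin> D (e - {Max e})" by metis
  have in_P: "f e \<in> P" if "e \<in> [V]\<^bsup>Suc k\<^esup>" for e
    using f(1)[OF that] down[OF nsets_Diff_Min[OF that]] by (auto simp: down_sets_def)
  have "\<not> f (e - {Min e}) \<le> f (e - {Max e})" if e: "e \<in> [V]\<^bsup>Suc (Suc k)\<^esup>" for e
  proof
    assume le: "f (e - {Min e}) \<le> f (e - {Max e})"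
    let ?v = "e - {Max e} - {Min (e - {Max e})}"
    have "f (e - {Max e}) \<in> D ?v"
      using f(1)[OF nsets_Diff_Max[OF e]] .
    moreover have "D ?v \<in> down_sets P"
      using down[OF nsets_Diff_Min[OF nsets_Diff_Max[OF e]]] .
    ultimately have "f (e - {Min e}) \<in> D ?v"
      using le in_P[OF nsets_Diff_Min[OF e]] by (auto simp: down_sets_def)
    then show False
      using f(2)[OF nsets_Diff_Min[OF e]] Diff_Min_Diff_Max[OF e] by simp
  qed
  then show ?thesis using in_P unfolding shift_hom_def by blast
qed

lemma shift_hom_1_imp_card_le:
  assumes f: "shift_hom V 1 P f" and "finite P"
  shows "card V \<le> card P"
proof -
  have "f {x} \<noteq> f {y}" if "x \<in> V" "y \<in> V" "x < y" for x y
  proof -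
    have "{x, y} \<in> [V]\<^bsup>Suc 1\<^esup>" "{x, y} - {x} = {y}" "{x, y} - {y} = {x}"
      using that by (auto simp: nsets_def)
    then show ?thesis using f that unfolding shift_hom_def by fastforce
  qed
  then have "inj_on (\<lambda>x. f {x}) V"
    by (intro inj_onI) (metis linorder_neqE)
  moreover have "(\<lambda>x. f {x}) ` V \<subseteq> P"
    using f by (auto simp: shift_hom_def nsets_one)
  ultimately show ?thesis using assms(2) by (rule card_inj_on_le)
qed

lemma ex_shift_hom_1_if_card_le:
  fixes V :: "'v::linorder set" and P :: "'a::order set"
  assumes "finite V" "finite P" "card V \<le> card P"
  shows "\<exists>f. shift_hom V 1 P f"
proof -
  obtain h where h: "bij_betw h {..<card P} P"
    and ext: "\<And>i j. j < card P \<Longrightarrow> i < j \<Longrightarrow> \<not> h j \<le> h i"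
    using finite_linear_extension[OF assms(2)] by blast
  define rank where "rank x = card {y \<in> V. y < x}" for x
  have rank_less_card: "rank x < card P" if "x \<in> V" for x
    using psubset_card_mono[of V "{y \<in> V. y < x}"] assms(1,3) that unfolding rank_def by force
  have rank_mono: "rank x < rank y" if "x \<in> V" "x < y" for x y
    unfolding rank_def using assms(1) that by (intro psubset_card_mono) auto
  have "shift_hom V 1 P (\<lambda>v. h (rank (Min v)))"
    unfolding shift_hom_def
  proof (intro conjI ballI)
    show "(\<lambda>v. h (rank (Min v))) \<in> [V]\<^bsup>1\<^esup> \<rightarrow> P"
      using rank_less_card bij_betwE[OF h] by (auto simp: nsets_one)
  next
    fix e assume "e \<in> [V]\<^bsup>Suc 1\<^esup>"
    then have "e \<in> [V]\<^bsup>2\<^esup>" by (simp add: numeral_2_eq_2)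
    then obtain x y where "e = {x, y}" "x \<in> V" "y \<in> V" "x < y"
      unfolding ordered_nsets_2_eq by blast
    moreover from this have "e - {Min e} = {y}" "e - {Max e} = {x}" by auto
    ultimately show "\<not> h (rank (Min (e - {Min e}))) \<le> h (rank (Min (e - {Max e})))"
      using ext[OF rank_less_card rank_mono] by simp
  qed
  then show ?thesis by blast
qed

section \<open>Colorings without monochromatic paths\<close>

abbreviation grid :: "'i set \<Rightarrow> nat \<Rightarrow> ('i \<Rightarrow> nat) set" where
  "grid I m \<equiv> I \<rightarrow>\<^sub>E {..<m}"

lemma path_edges_Suc:
  assumes "k < n"
  shows "path_edges (Suc k) n j = (\<lambda>i. j ` {i..i + k}) ` {1..n - k}"
  using assms by (simp add: path_edges_def Suc_diff_Suc)

lemma strict_mono_on_image_Diff_Min: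
  fixes j :: "nat \<Rightarrow> 'v::linorder"
  assumes "strict_mono_on {i..i + k} j"
  shows "j ` {i..i + k} - {Min (j ` {i..i + k})} = j ` {Suc i..<Suc i + k}"
proof -
  have less: "j i < j t" if "t \<in> {Suc i..<Suc i + k}" for t
    using strict_mono_onD[OF assms, of i t] that by simp
  have split: "{i..i + k} = insert i {Suc i..<Suc i + k}" by auto
  then have "Min (j ` {i..i + k}) = j i"
    using less by (intro Min_eqI) (auto intro: less_imp_le)
  moreover have "j i \<notin> j ` {Suc i..<Suc i + k}" using less by fastforce
  ultimately show ?thesis using split by simp
qed

lemma strict_mono_on_image_Diff_Max:
  fixes j :: "nat \<Rightarrow> 'v::linorder"
  assumes "strict_mono_on {i..i + k} j"
  shows "j ` {i..i + k} - {Max (j ` {i..i + k})} = j ` {i..<i + k}"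
proof -
  have less: "j t < j (i + k)" if "t \<in> {i..<i + k}" for t
    using strict_mono_onD[OF assms, of t "i + k"] that by simp
  have split: "{i..i + k} = insert (i + k) {i..<i + k}" by auto
  then have "Max (j ` {i..i + k}) = j (i + k)"
    using less by (intro Max_eqI) (auto intro: less_imp_le)
  moreover have "j (i + k) \<notin> j ` {i..<i + k}" using less by fastforce
  ultimately show ?thesis using split by simp
qed

lemma monotone_path_imp_strict_mono_on:
  "monotone_path N n j \<Longrightarrow> I \<subseteq> {1..n} \<Longrightarrow> strict_mono_on I j"
  unfolding monotone_path_def by (elim conjE monotone_on_subset)

lemma monotone_path_image_in_nsets:
  assumes "monotone_path N n j" "I \<subseteq> {1..n}" "card I = k"
  shows "j ` I \<in> [{1..N}]\<^bsup>k\<^esup>"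
proof -
  have "inj_on j I"
    by (rule strict_mono_on_imp_inj_on[OF monotone_path_imp_strict_mono_on[OF assms(1,2)]])
  moreover have "finite I" using assms(2) finite_subset by blast
  moreover have "j ` I \<subseteq> {1..N}" using assms unfolding monotone_path_def by blast
  ultimately show ?thesis using assms(3) by (auto simp: nsets_def card_image)
qed

lemma shift_hom_grid_imp_ex_increase:
  assumes f: "shift_hom V k (grid I m) f" and e: "e \<in> [V]\<^bsup>Suc k\<^esup>"
  shows "\<exists>a\<in>I. f (e - {Max e}) a < f (e - {Min e}) a"
proof -
  have "f (e - {Min e}) \<in> grid I m" "f (e - {Max e}) \<in> grid I m"
    using f nsets_Diff_Min[OF e] nsets_Diff_Max[OF e] by (auto simp: shift_hom_def)
  moreover obtain a where "f (e - {Max e}) a < f (e - {Min e}) a"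
    using f e by (auto simp: shift_hom_def le_fun_def not_le)
  ultimately show ?thesis by (metis PiE_arb order_less_irrefl)
qed

lemma shift_hom_grid_imp_not_forces:
  assumes f: "shift_hom {1..N} k (grid {1..q} (n - k)) f" and "k < n"
  shows "\<not> forces_mono_path (Suc k) q n N"
proof
  assume forces: "forces_mono_path (Suc k) q n N"
  obtain \<chi> where colors: "\<And>e. e \<in> [{1..N}]\<^bsup>Suc k\<^esup> \<Longrightarrow> \<chi> e \<in> {1..q}"
    and increase: "\<And>e. e \<in> [{1..N}]\<^bsup>Suc k\<^esup> \<Longrightarrow> f (e - {Max e}) (\<chi> e) < f (e - {Min e}) (\<chi> e)"
    using shift_hom_grid_imp_ex_increase[OF f] by metis
  then obtain j a where j: "monotone_path N n j" and a: "\<forall>e\<in>path_edges (Suc k) n j. \<chi> e = a"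
    using forces unfolding forces_mono_path_def by blast
  define v where "v i = j ` {i..<i + k}" for i
  have edge: "j ` {i..i + k} \<in> [{1..N}]\<^bsup>Suc k\<^esup>" if "i \<in> {1..n - k}" for i
    using that by (intro monotone_path_image_in_nsets[OF j]) auto
  have color: "\<chi> (j ` {i..i + k}) = a" if "i \<in> {1..n - k}" for i
    using a that \<open>k < n\<close> by (simp add: path_edges_Suc)
  have step: "f (v i) a < f (v (Suc i)) a" if i: "i \<in> {1..n - k}" for i
  proof -
    have "strict_mono_on {i..i + k} j"
      using i by (intro monotone_path_imp_strict_mono_on[OF j]) auto
    then show ?thesis
      using increase[OF edge[OF i]] color[OF i]
      by (simp only: v_def strict_mono_on_image_Diff_Max strict_mono_on_image_Diff_Min)
  qed
  have "t \<le> n - k \<Longrightarrow> t \<le> f (v (Suc t)) a" for t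
  proof (induction t)
    case (Suc t)
    then show ?case using step[of "Suc t"] by simp
  qed simp
  then have "n - k \<le> f (v (Suc (n - k))) a" by simp
  moreover have "v (Suc (n - k)) \<in> [{1..N}]\<^bsup>k\<^esup>"
    unfolding v_def using \<open>k < n\<close> by (intro monotone_path_image_in_nsets[OF j]) auto
  then have "f (v (Suc (n - k))) \<in> grid {1..q} (n - k)"
    using f by (auto simp: shift_hom_def)
  moreover have "a \<in> {1..q}" using colors[OF edge[of 1]] color[of 1] \<open>k < n\<close> by simp
  ultimately show False using PiE_mem by fastforce
qed

text \<open>A path with \<open>l\<close> edges of size \<open>Suc k\<close> has \<open>l + k\<close> vertices, the last \<open>k\<close> of them forming \<open>v\<close>.
  The edges are listed explicitly because for \<open>l = 0\<close> truncated subtraction makes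
  \<open>path_edges (Suc k) k j\<close> nonempty.\<close>

definition mono_run_to ::
    "nat \<Rightarrow> nat \<Rightarrow> (nat set \<Rightarrow> nat) \<Rightarrow> nat \<Rightarrow> nat \<Rightarrow> nat set \<Rightarrow> bool" where
  "mono_run_to N k \<chi> a l v \<longleftrightarrow> (\<exists>j. monotone_path N (l + k) j \<and>
     (\<forall>i\<in>{1..l}. \<chi> (j ` {i..i + k}) = a) \<and> v = j ` {Suc l..<Suc l + k})"

lemma mono_run_to_0:
  assumes "v \<in> [{1..N}]\<^bsup>k\<^esup>"
  shows "mono_run_to N k \<chi> a 0 v"
proof -
  have v: "finite v" "card v = k" "v \<subseteq> {1..N}" using assms by (auto simp: nsets_def)
  obtain h where h: "bij_betw h {..<k} v" "strict_mono_on {..<k} h"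
    using ex_bij_betw_strict_mono_card[OF v(1)] v(2) by metis
  define j where "j i = h (i - 1)" for i
  have "j ` {1..k} = j ` Suc ` {..<k}" by (simp add: image_Suc_lessThan)
  then have image: "j ` {1..k} = v" using h(1) by (simp add: image_image j_def bij_betw_def)
  moreover have "strict_mono_on {1..k} j"
    by (auto simp: j_def intro!: strict_mono_onI strict_mono_onD[OF h(2)])
  ultimately have "monotone_path N k j" using v(3) by (simp add: monotone_path_def)
  then show ?thesis
    using image unfolding mono_run_to_def
    by (intro exI[of _ j]) (simp add: atLeastLessThanSuc_atLeastAtMost)
qed

lemma monotone_path_snoc:
  assumes j: "monotone_path N n j" and "x \<in> {1..N}" and last: "n \<ge> 1 \<Longrightarrow> j n < x"
  shows "monotone_path N (Suc n) (j(Suc n := x))"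
proof -
  have "j r < x" if "r \<in> {1..n}" for r
    using j that last by (cases "r = n")
      (auto simp: monotone_path_def dest: strict_mono_onD[of _ j r n])
  then have "strict_mono_on {1..Suc n} (j(Suc n := x))"
    using j by (auto simp: monotone_path_def strict_mono_on_def)
  moreover have "(j(Suc n := x)) ` {1..Suc n} \<subseteq> {1..N}"
    using j assms(2) by (auto simp: monotone_path_def le_Suc_eq)
  ultimately show ?thesis by (simp add: monotone_path_def)
qed

lemma mono_run_to_Suc:
  assumes run: "mono_run_to N k \<chi> a l (e - {Max e})" and k: "k \<ge> 1"
    and e: "e \<in> [{1..N}]\<^bsup>Suc k\<^esup>" and color: "\<chi> e = a"
  shows "mono_run_to N k \<chi> a (Suc l) (e - {Min e})"
proof -
  obtain j where j: "monotone_path N (l + k) j" and colors: "\<forall>i\<in>{1..l}. \<chi> (j ` {i..i + k}) = a"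
    and v: "e - {Max e} = j ` {Suc l..<Suc l + k}"
    using run unfolding mono_run_to_def by blast
  have fin: "finite e" "e \<noteq> {}" "e \<subseteq> {1..N}" using e by (auto simp: nsets_def)
  define j' where "j' = j(Suc (l + k) := Max e)"
  have "j (l + k) \<in> e - {Max e}" unfolding v using k by auto
  then have "j (l + k) < Max e" using fin(1) by (auto simp: less_le)
  then have j': "monotone_path N (Suc (l + k)) j'"
    unfolding j'_def using j fin Max_in[of e] by (intro monotone_path_snoc) auto
  have same: "j' ` I = j ` I" if "I \<subseteq> {1..l + k}" for I
    unfolding j'_def using that by (intro image_cong) auto
  have "{Suc l..Suc l + k} = insert (Suc (l + k)) {Suc l..<Suc l + k}" by auto
  moreover have "j' (Suc (l + k)) = Max e" by (simp add: j'_def)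
  moreover have "j' ` {Suc l..<Suc l + k} = e - {Max e}" unfolding v by (rule same) auto
  ultimately have "j' ` {Suc l..Suc l + k} = insert (Max e) (e - {Max e})" by simp
  then have last: "j' ` {Suc l..Suc l + k} = e"
    using Max_in[OF fin(1,2)] by (simp add: insert_absorb)
  have "strict_mono_on {Suc l..Suc l + k} j'"
    by (rule monotone_path_imp_strict_mono_on[OF j']) auto
  then have "e - {Min e} = j' ` {Suc (Suc l)..<Suc (Suc l) + k}"
    using strict_mono_on_image_Diff_Min[of "Suc l" k j'] last by simp
  moreover have "\<chi> (j' ` {i..i + k}) = a" if "i \<in> {1..Suc l}" for i
  proof (cases "i = Suc l")
    case False
    then show ?thesis using colors that same[of "{i..i + k}"] by auto
  qed (use last color in simp)
  ultimately show ?thesis using j' unfolding mono_run_to_def by (intro exI[of _ j']) simp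
qed

lemma ex_shift_hom_grid_if_no_mono_run:
  assumes \<chi>: "\<chi> \<in> [{1..N}]\<^bsup>Suc k\<^esup> \<rightarrow> {1..q}" and "1 \<le> k" "1 \<le> m"
    and no_run: "\<And>a v. \<not> mono_run_to N k \<chi> a m v"
  shows "\<exists>f. shift_hom {1..N} k (grid {1..q} m) f"
proof -
  define longest where "longest v a = Max {l\<in>{..<m}. mono_run_to N k \<chi> a l v}" for v a
  have longest: "longest v a < m" "mono_run_to N k \<chi> a (longest v a) v"
    if "v \<in> [{1..N}]\<^bsup>k\<^esup>" for v a
  proof -
    have "0 \<in> {l\<in>{..<m}. mono_run_to N k \<chi> a l v}"
      using mono_run_to_0[OF that] \<open>1 \<le> m\<close> by simp
    then have "longest v a \<in> {l\<in>{..<m}. mono_run_to N k \<chi> a l v}"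
      unfolding longest_def by (intro Max_in) auto
    then show "longest v a < m" "mono_run_to N k \<chi> a (longest v a) v" by simp_all
  qed
  have le_longest: "l \<le> longest v a" if "l < m" "mono_run_to N k \<chi> a l v" for l v a
    unfolding longest_def using that by (intro Max_ge) auto
  have "\<not> restrict (longest (e - {Min e})) {1..q} \<le> restrict (longest (e - {Max e})) {1..q}"
    if e: "e \<in> [{1..N}]\<^bsup>Suc k\<^esup>" for e
  proof -
    let ?a = "\<chi> e" and ?u = "e - {Max e}" and ?v = "e - {Min e}"
    have run: "mono_run_to N k \<chi> ?a (Suc (longest ?u ?a)) ?v"
      using longest(2)[OF nsets_Diff_Max[OF e]] by (intro mono_run_to_Suc[OF _ \<open>1 \<le> k\<close> e]) simp_all
    moreover have "Suc (longest ?u ?a) \<noteq> m" using run no_run by metis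
    ultimately have "Suc (longest ?u ?a) \<le> longest ?v ?a"
      using longest(1)[OF nsets_Diff_Max[OF e], of ?a] by (intro le_longest) simp_all
    moreover have "?a \<in> {1..q}" using \<chi> e by blast
    ultimately have "\<not> restrict (longest ?v) {1..q} ?a \<le> restrict (longest ?u) {1..q} ?a" by simp
    then show ?thesis unfolding le_fun_def by blast
  qed
  then show ?thesis
    unfolding shift_hom_def using longest(1)
    by (intro exI[of _ "\<lambda>v. restrict (longest v) {1..q}"]) auto
qed

lemma not_forces_imp_ex_shift_hom_grid:
  assumes not_forces: "\<not> forces_mono_path (Suc k) q n N" and "1 \<le> k" "k < n"
  shows "\<exists>f. shift_hom {1..N} k (grid {1..q} (n - k)) f"
proof -
  obtain \<chi> where \<chi>: "\<chi> \<in> [{1..N}]\<^bsup>Suc k\<^esup> \<rightarrow> {1..q}"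
    and no_path: "\<And>j a. monotone_path N n j \<Longrightarrow> \<not> (\<forall>e\<in>path_edges (Suc k) n j. \<chi> e = a)"
    using not_forces unfolding forces_mono_path_def by blast
  have "\<not> mono_run_to N k \<chi> a (n - k) v" for a v
  proof
    assume "mono_run_to N k \<chi> a (n - k) v"
    then obtain j where "monotone_path N n j" "\<forall>i\<in>{1..n - k}. \<chi> (j ` {i..i + k}) = a"
      using \<open>k < n\<close> unfolding mono_run_to_def by auto
    then show False using no_path[of j a] \<open>k < n\<close> by (simp add: path_edges_Suc)
  qed
  then show ?thesis
    using \<open>1 \<le> k\<close> \<open>k < n\<close> by (intro ex_shift_hom_grid_if_no_mono_run[OF \<chi>]) auto
qed

theorem less_mono_path_number_iff:
  assumes "1 \<le> k" "k < n"
  shows "N < mono_path_number (Suc k) q n \<longleftrightarrow>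
    (\<exists>f. shift_hom {1..N} k (grid {1..q} (n - k)) f)"
proof
  assume "N < mono_path_number (Suc k) q n"
  then have "\<not> forces_mono_path (Suc k) q n N"
    unfolding mono_path_number_def by (rule not_less_Least)
  then show "\<exists>f. shift_hom {1..N} k (grid {1..q} (n - k)) f"
    by (rule not_forces_imp_ex_shift_hom_grid[OF _ assms])
next
  assume "\<exists>f. shift_hom {1..N} k (grid {1..q} (n - k)) f"
  then obtain f where f: "shift_hom {1..N} k (grid {1..q} (n - k)) f" ..
  let ?M = "mono_path_number (Suc k) q n"
  have "forces_mono_path (Suc k) q n ?M"
    unfolding mono_path_number_def
    by (rule LeastI_ex, rule forces_mono_path_exists) (use assms in simp_all)
  moreover have "\<not> forces_mono_path (Suc k) q n ?M" if "?M \<le> N"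
    by (rule shift_hom_grid_imp_not_forces[OF shift_hom_subset[OF f] assms(2)]) (use that in simp)
  ultimately show "N < ?M" by (meson not_le)
qed

section \<open>Down-sets and antichains of the grid\<close>

lemma grid_eq_fun_upd:
  assumes "i \<in> I"
  shows "grid I m = {y(i := v) |y v. y \<in> grid (I - {i}) m \<and> v < m}"
proof -
  have "grid I m = grid (insert i (I - {i})) m" using assms by (simp add: insert_absorb)
  then show ?thesis unfolding PiE_insert_eq by auto
qed

lemma card_down_sets_grid_le:
  assumes "finite I" "i \<in> I"
  shows "card (down_sets (grid I m)) \<le> (m + 1) ^ (m ^ (card I - 1))"
proof -
  define C where "C y = (\<lambda>v. y(i := v)) ` {..<m}" for y :: "'a \<Rightarrow> nat"
  have "card (down_sets (grid I m)) \<le> (m + 1) ^ card (grid (I - {i}) m)"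
  proof (rule card_down_sets_chain_cover)
    show "finite (grid I m)" "finite (grid (I - {i}) m)"
      using assms(1) by (simp_all add: finite_PiE)
    show "grid I m = (\<Union>y\<in>grid (I - {i}) m. C y)"
      unfolding grid_eq_fun_upd[OF assms(2)] C_def by blast
    show "Complete_Partial_Order.chain (\<le>) (C y)" for y
      unfolding C_def chain_def by (auto simp: le_fun_def)
    show "card (C y) \<le> m" for y
      unfolding C_def using card_image_le[of "{..<m}"] by fastforce
  qed
  also have "card (grid (I - {i}) m) = m ^ (card I - 1)"
    using assms by (simp add: card_PiE)
  finally show ?thesis .
qed

lemma antichain_grid_level:
  assumes "finite I"
  shows "antichain {x \<in> grid I m. sum x I = t}"
  unfolding antichain_def
proof (intro ballI impI)
  fix x y assume x: "x \<in> {x \<in> grid I m. sum x I = t}" and y: "y \<in> {x \<in> grid I m. sum x I = t}"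
    and "x \<le> y"
  then have "x i = y i" if "i \<in> I" for i
    using assms that by (intro sum_mono_inv[of x I y]) (auto simp: le_fun_def)
  then show "x = y" using x y by (blast intro: PiE_ext)
qed

lemma card_grid_sum_mod_ge:
  assumes "finite I" "i \<in> I" "m \<ge> 1"
  shows "m ^ (card I - 1) \<le> card {x \<in> grid I m. sum x I mod m = m - 1}"
proof -
  define e where "e y = y(i := m - 1 - sum y (I - {i}) mod m)" for y
  have "inj_on e (grid (I - {i}) m)"
  proof (rule inj_onI, rule PiE_ext)
    fix y z t assume eq: "e y = e z" and t: "t \<in> I - {i}"
    show "y t = z t" using fun_cong[OF eq, of t] t by (simp add: e_def)
  qed
  moreover have "e y \<in> {x \<in> grid I m. sum x I mod m = m - 1}" if y: "y \<in> grid (I - {i}) m" for y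
  proof -
    let ?s = "sum y (I - {i})"
    have "m - 1 - ?s mod m < m" using assms(3) by simp
    then have "e y \<in> grid I m"
      using y unfolding e_def grid_eq_fun_upd[OF assms(2)] by blast
    have "sum (e y) I = e y i + sum (e y) (I - {i})"
      using assms by (simp add: sum.remove)
    also have "sum (e y) (I - {i}) = ?s"
      unfolding e_def by (intro sum.cong) auto
    finally have "sum (e y) I = (m - 1 - ?s mod m) + (?s div m * m + ?s mod m)"
      by (simp add: e_def)
    also have "\<dots> = ?s div m * m + (m - 1)"
      using mod_less_divisor[of m ?s] assms(3) by linarith
    finally have "sum (e y) I mod m = (m - 1) mod m" by (simp only: mod_mult_self3)
    then show ?thesis using \<open>e y \<in> grid I m\<close> assms(3) by simp
  qed
  ultimately have "card (grid (I - {i}) m) \<le> card {x \<in> grid I m. sum x I mod m = m - 1}"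
    using assms(1) by (intro card_inj_on_le) (auto simp: finite_PiE)
  then show ?thesis using assms by (simp add: card_PiE)
qed

text \<open>Restricting to coordinate sums congruent to \<open>m - 1\<close> leaves only \<open>card I - 1\<close> possible sums.\<close>

lemma ex_large_antichain_grid:
  assumes "finite I" "card I \<ge> 2" "m \<ge> 1"
  shows "\<exists>A\<subseteq>grid I m. antichain A \<and> m ^ (card I - 1) \<le> (card I - 1) * card A"
proof -
  let ?S = "{x \<in> grid I m. sum x I mod m = m - 1}"
  have "sum x I div m < card I - 1" if "x \<in> ?S" for x
  proof -
    have "sum x I \<le> (\<Sum>i\<in>I. m - 1)"
      using that by (intro sum_mono) (auto dest!: PiE_mem)
    also have "\<dots> < (card I - 1) * m + (m - 1)"
      using assms(2,3) by (cases m; cases "card I") auto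
    finally have "sum x I div m * m + (m - 1) < (card I - 1) * m + (m - 1)"
      using that by (metis (mono_tags, lifting) div_mult_mod_eq mem_Collect_eq)
    then show ?thesis by simp
  qed
  then have "(\<lambda>x. sum x I div m) \<in> ?S \<rightarrow> {..<card I - 1}" by blast
  moreover have "finite ?S" using assms(1) by (simp add: finite_PiE)
  moreover have "{..<card I - 1} \<noteq> {}" using assms(2) by (simp add: lessThan_empty_iff)
  ultimately have "\<exists>r\<in>{..<card I - 1}.
      card ?S \<le> card ((\<lambda>x. sum x I div m) -` {r} \<inter> ?S) * card {..<card I - 1}"
    by (intro pigeonhole_card) simp_all
  then obtain r where r: "card ?S \<le> card ((\<lambda>x. sum x I div m) -` {r} \<inter> ?S) * (card I - 1)"
    by (auto simp only: card_lessThan)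
  let ?A = "(\<lambda>x. sum x I div m) -` {r} \<inter> ?S"
  have "?A \<subseteq> {x \<in> grid I m. sum x I = r * m + (m - 1)}"
  proof
    fix x assume "x \<in> ?A"
    then show "x \<in> {x \<in> grid I m. sum x I = r * m + (m - 1)}"
      using div_mult_mod_eq[of "sum x I" m] by auto
  qed
  then have "antichain ?A"
    by (rule antichain_subset[OF antichain_grid_level[OF assms(1)]])
  moreover have "m ^ (card I - 1) \<le> (card I - 1) * card ?A"
  proof -
    obtain i where "i \<in> I" using assms(2) by fastforce
    then have "m ^ (card I - 1) \<le> card ?S" by (rule card_grid_sum_mod_ge[OF assms(1) _ assms(3)])
    then show ?thesis using r by (simp add: mult.commute)
  qed
  ultimately show ?thesis by (intro exI[of _ ?A]) blast
qed

section \<open>Tower bounds\<close>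

lemma tower_Suc_Suc: "tower (Suc (Suc j)) x = tower (Suc j) (2 powr x)"
  by (induction j) simp_all

lemma shift_hom_nat_set_le_tower:
  fixes P :: "nat set set"
  assumes "shift_hom V (Suc j) P f" "finite V" "finite P" "real (card P) + 1 \<le> y"
  shows "real (card V) + 1 \<le> tower (Suc j) y"
  using assms
proof (induction j arbitrary: P f y)
  case 0
  then have "card V \<le> card P" using shift_hom_1_imp_card_le by auto
  then show ?case using 0 by simp
next
  case (Suc j)
  obtain e :: "nat set set \<Rightarrow> nat set" where e: "order_embedding_on (down_sets P) e"
    using ex_order_embedding_nat_set[OF finite_down_sets[OF Suc.prems(3)]] by blast
  have card: "card (e ` down_sets P) = card (down_sets P)"
    by (rule card_image[OF order_embedding_on_imp_inj_on[OF e]])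
  have "card (down_sets P) + 1 \<le> 2 ^ card P + 2 ^ card P"
    using card_down_sets_le[OF Suc.prems(3)] by (intro add_mono) simp_all
  then have "real (card (down_sets P) + 1) \<le> real (2 ^ Suc (card P))"
    unfolding of_nat_le_iff by simp
  also have "\<dots> = 2 powr (real (card P) + 1)"
    using powr_realpow[of "2::real" "Suc (card P)"] by (simp add: add.commute)
  also have "\<dots> \<le> 2 powr y" using Suc.prems(4) by simp
  finally have "real (card (e ` down_sets P)) + 1 \<le> 2 powr y" using card by simp
  then have "real (card V) + 1 \<le> tower (Suc j) (2 powr y)"
    using shift_hom_embedding[OF e shift_hom_imp_down_sets[OF Suc.prems(1)]]
      finite_down_sets[OF Suc.prems(3)] Suc.prems(2) by (intro Suc.IH) simp_all
  then show ?case by (simp only: tower_Suc_Suc)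
qed

lemma shift_hom_le_tower:
  assumes f: "shift_hom V (Suc j) P f" and "finite V" "finite P" "real (card P) + 1 \<le> y"
  shows "real (card V) + 1 \<le> tower (Suc j) y"
proof -
  obtain e :: "'b \<Rightarrow> nat set" where e: "order_embedding_on P e"
    using ex_order_embedding_nat_set[OF assms(3)] by blast
  then show ?thesis
    using assms shift_hom_nat_set_le_tower[OF shift_hom_embedding[OF e f]]
    by (simp add: card_image order_embedding_on_imp_inj_on)
qed

text \<open>The additive constant \<open>8\<close> makes the invariant \<open>2 * x + 8\<close> reproduce itself under
  \<open>w \<mapsto> 2 ^ (w div 2)\<close>, since \<open>2 powr (7 / 2) \<ge> 10\<close>.\<close>

lemma double_two_powr_add_8_le:
  fixes x :: real
  assumes "x \<ge> 0" "2 * x + 8 \<le> real w"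
  shows "2 * 2 powr x + 8 \<le> 2 ^ (w div 2)"
proof -
  have "(10::real) \<le> 2 powr (7 / 2)"
  proof (rule power2_le_imp_le)
    have "(2 powr (7 / 2) :: real)\<^sup>2 = 2 powr 7"
      by (simp add: power2_eq_square flip: powr_add)
    also have "\<dots> = 128" using powr_realpow[of "2::real" 7] by simp
    finally show "(10::real)\<^sup>2 \<le> (2 powr (7 / 2))\<^sup>2" by simp
  qed simp
  moreover have "1 \<le> 2 powr x" using assms(1) by (simp add: ge_one_powr_ge_zero)
  ultimately have "2 * 2 powr x + 8 \<le> 2 powr (7 / 2) * 2 powr x"
    using mult_right_mono[of 10 "2 powr (7 / 2)" "2 powr x"] by linarith
  also have "\<dots> = 2 powr (x + 7 / 2)" by (simp add: powr_add)
  also have "\<dots> \<le> 2 powr real (w div 2)"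
  proof (rule powr_mono)
    have "w \<le> 2 * (w div 2) + 1" by simp
    then have "real w \<le> 2 * real (w div 2) + 1" by linarith
    then show "x + 7 / 2 \<le> real (w div 2)" using assms(2) by linarith
  qed simp
  also have "\<dots> = 2 ^ (w div 2)" by (simp add: powr_realpow)
  finally show ?thesis .
qed

lemma ex_shift_hom_nat_set_if_le_tower:
  fixes P A :: "nat set set"
  assumes "finite V" "finite P" "A \<subseteq> P" "antichain A" "x \<ge> 0" "2 * x + 8 \<le> real (card A)"
    and "real (card V) \<le> tower (Suc j) x"
  shows "\<exists>f. shift_hom V (Suc j) P f"
  using assms
proof (induction j arbitrary: P A x)
  case 0
  have "real (card V) \<le> real (card A)" using 0 by simp
  also have "\<dots> \<le> real (card P)" using card_mono[OF 0(2,3)] by simp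
  finally show ?case using ex_shift_hom_1_if_card_le[OF 0(1,2)] by simp
next
  case (Suc j)
  obtain e :: "nat set set \<Rightarrow> nat set" where e: "order_embedding_on (down_sets P) e"
    using ex_order_embedding_nat_set[OF finite_down_sets[OF Suc.prems(2)]] by blast
  obtain A' where A': "A' \<subseteq> down_sets P" "antichain A'" "2 ^ (card A div 2) \<le> card A'"
    using ex_large_antichain_down_sets[OF finite_subset[OF Suc.prems(3,2)] Suc.prems(3,4)] by blast
  have e': "order_embedding_on A' e" by (rule order_embedding_on_subset[OF e A'(1)])
  have "2 * 2 powr x + 8 \<le> 2 ^ (card A div 2)"
    by (rule double_two_powr_add_8_le[OF Suc.prems(5,6)])
  also have "\<dots> \<le> real (card A')"
    using A'(3) by (metis of_nat_le_iff of_nat_numeral of_nat_power)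
  also have "card A' = card (e ` A')"
    by (simp add: card_image order_embedding_on_imp_inj_on[OF e'])
  finally have "\<exists>g. shift_hom V (Suc j) (e ` down_sets P) g"
    using Suc.prems(1,7) finite_down_sets[OF Suc.prems(2)] A'(1) antichain_image[OF A'(2) e']
    by (intro Suc.IH[of _ "e ` A'" "2 powr x"]) (auto simp: tower_Suc_Suc simp del: tower.simps)
  then show ?case
    using shift_hom_inv_embedding[OF e] down_sets_imp_ex_shift_hom by blast
qed

lemma ex_shift_hom_if_le_tower:
  assumes "finite V" "finite P" "A \<subseteq> P" "antichain A" "x \<ge> 0" "2 * x + 8 \<le> real (card A)"
    and "real (card V) \<le> tower (Suc j) x"
  shows "\<exists>f. shift_hom V (Suc j) P f"
proof -
  obtain e :: "'b \<Rightarrow> nat set" where e: "order_embedding_on P e"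
    using ex_order_embedding_nat_set[OF assms(2)] by blast
  then have e': "order_embedding_on A e" using assms(3) by (rule order_embedding_on_subset)
  have "\<exists>f. shift_hom V (Suc j) (e ` P) f"
  proof (rule ex_shift_hom_nat_set_if_le_tower)
    show "antichain (e ` A)" by (rule antichain_image[OF assms(4) e'])
    show "2 * x + 8 \<le> real (card (e ` A))"
      using assms(6) by (simp add: card_image order_embedding_on_imp_inj_on[OF e'])
  qed (use assms in auto)
  then show ?thesis using shift_hom_inv_embedding[OF e] by blast
qed

definition lower_const :: "nat \<Rightarrow> real" where
  "lower_const q = 1 / (10 * real (q - 1) * 2 ^ (q - 1))"

lemma lower_const_mult_power_le:
  fixes m n q w :: nat
  assumes "m \<ge> 10" "n \<le> 2 * m" "q \<ge> 2" "m ^ (q - 1) \<le> (q - 1) * w"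
  shows "2 * (lower_const q * real n ^ (q - 1)) + 8 \<le> real w"
    (is "2 * ?x + 8 \<le> _")
proof -
  have "q - 2 < 10 ^ (q - 2)" by (rule power_gt_expt) simp
  then have "(q - 1) * 10 \<le> 10 ^ (q - 2) * 10" using assms(3) by simp
  also have "\<dots> = 10 ^ (q - 1)"
    using assms(3) by (simp flip: power_Suc2 add: Suc_diff_Suc numeral_2_eq_2)
  also have "\<dots> \<le> m ^ (q - 1)" using assms(1) by (intro power_mono) auto
  finally have "(q - 1) * 10 \<le> (q - 1) * w" using assms(4) by linarith
  then have "w \<ge> 10" using assms(3) by simp
  have "real n ^ (q - 1) \<le> (2 * real m) ^ (q - 1)" using assms(2) by (intro power_mono) auto
  also have "\<dots> = 2 ^ (q - 1) * real (m ^ (q - 1))" by (simp add: power_mult_distrib)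
  also have "\<dots> \<le> 2 ^ (q - 1) * real ((q - 1) * w)"
    using assms(4) by (intro mult_left_mono) (simp_all only: of_nat_le_iff, simp)
  finally have "?x \<le> real w / 10"
    using assms(3) by (simp add: lower_const_def field_simps)
  then have "2 * ?x + 8 \<le> 2 * (real w / 10) + 8" by (intro add_mono mult_left_mono) simp_all
  also have "\<dots> \<le> real w" using \<open>w \<ge> 10\<close> by simp
  finally show ?thesis .
qed

theorem mono_path_number_ge_tower:
  assumes "k \<ge> 1" "q \<ge> 2" "k + 10 \<le> n" "2 * k \<le> n"
  shows "tower k (lower_const q * real n ^ (q - 1))
    \<le> real (mono_path_number (Suc k) q n)"
proof (rule ccontr)
  define x where "x = lower_const q * real n ^ (q - 1)"
  let ?M = "mono_path_number (Suc k) q n"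
  assume "\<not> ?thesis"
  then have "real (card {1..?M}) \<le> tower (Suc (k - 1)) x"
    using assms(1) by (simp add: x_def)
  moreover obtain A where A: "A \<subseteq> grid {1..q} (n - k)" "antichain A"
    "(n - k) ^ (q - 1) \<le> (q - 1) * card A"
    using ex_large_antichain_grid[of "{1..q}" "n - k"] assms by (simp add: le_diff_conv2) blast
  moreover have "2 * x + 8 \<le> real (card A)"
    unfolding x_def using assms A(3) by (intro lower_const_mult_power_le[of "n - k"]) auto
  moreover have "x \<ge> 0" by (simp add: x_def lower_const_def)
  ultimately have "\<exists>f. shift_hom {1..?M} (Suc (k - 1)) (grid {1..q} (n - k)) f"
    by (intro ex_shift_hom_if_le_tower[of _ _ A x]) (simp_all add: finite_PiE)
  then have "?M < ?M" using assms less_mono_path_number_iff[of k n ?M q] by simp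
  then show False by simp
qed

lemma card_down_sets_grid_add_1_le:
  assumes "q \<ge> 1" "1 \<le> m" "m + 2 \<le> n"
  shows "real (card (down_sets (grid {1..q} m))) + 1 \<le> 2 powr (real n ^ (q - 1) * log 2 (real n))"
proof -
  have "card (down_sets (grid {1..q} m)) \<le> (m + 1) ^ (m ^ (q - 1))"
    using card_down_sets_grid_le[of "{1..q}" q m] assms(1) by simp
  also have "\<dots> < n ^ (m ^ (q - 1))" using assms by (intro power_strict_mono) auto
  also have "\<dots> \<le> n ^ (n ^ (q - 1))" using assms by (intro power_increasing power_mono) auto
  finally have "real (card (down_sets (grid {1..q} m))) + 1 \<le> real (n ^ (n ^ (q - 1)))"
    by linarith
  also have "\<dots> = real n powr (real n ^ (q - 1))"
    using assms by (simp add: powr_realpow flip: of_nat_power)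
  also have "\<dots> = 2 powr (real n ^ (q - 1) * log 2 (real n))"
    using assms by (simp add: powr_def log_def)
  finally show ?thesis .
qed

theorem mono_path_number_le_tower:
  assumes "k \<ge> 2" "q \<ge> 1" "k < n"
  shows "real (mono_path_number (Suc k) q n) \<le> tower k (real n ^ (q - 1) * log 2 (real n))"
proof -
  obtain j where k: "k = Suc (Suc j)" using assms(1) by (metis Suc_le_D numeral_2_eq_2 Suc_le_mono)
  show ?thesis
  proof (cases "mono_path_number (Suc k) q n")
    case 0
    then show ?thesis using k by simp
  next
    case (Suc N)
    obtain f where f: "shift_hom {1..N} (Suc (Suc j)) (grid {1..q} (n - k)) f"
      using less_mono_path_number_iff[of k n N q] Suc assms k by auto
    have "real (card (down_sets (grid {1..q} (n - k)))) + 1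
        \<le> 2 powr (real n ^ (q - 1) * log 2 (real n))"
      using assms by (intro card_down_sets_grid_add_1_le) auto
    then have "real (card {1..N}) + 1 \<le> tower (Suc j) (2 powr (real n ^ (q - 1) * log 2 (real n)))"
      by (intro shift_hom_le_tower[OF shift_hom_imp_down_sets[OF f]] finite_down_sets)
        (simp_all add: finite_PiE)
    then show ?thesis using Suc k by (simp add: tower_Suc_Suc del: tower.simps)
  qed
qed

theorem theorem3:
  fixes k q :: nat
  assumes "k \<ge> 3" and "q \<ge> 2"
  shows "\<exists>c c' :: real. c > 0 \<and> c' > 0 \<and>
    (\<forall>n :: nat. n \<ge> 4 * k \<longrightarrow>
       tower (k - 1) (c * real n ^ (q - 1)) \<le> real (mono_path_number k q n) \<and>
       real (mono_path_number k q n) \<le> tower (k - 1) (c' * real n ^ (q - 1) * log 2 (real n)))"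
proof (intro exI conjI allI impI)
  show "lower_const q > 0" using assms by (simp add: lower_const_def)
  show "(1::real) > 0" by simp
  fix n assume n: "n \<ge> 4 * k"
  have k: "Suc (k - 1) = k" using assms(1) by simp
  show "tower (k - 1) (lower_const q * real n ^ (q - 1))
    \<le> real (mono_path_number k q n)"
    using mono_path_number_ge_tower[of "k - 1" q n] assms n unfolding k by simp
  show "real (mono_path_number k q n) \<le> tower (k - 1) (1 * real n ^ (q - 1) * log 2 (real n))"
    using mono_path_number_le_tower[of "k - 1" q n] assms n unfolding k by simp
qed

end
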